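(* Let $(x^k)_{k\ge1}$ be the iterates generated by the GEP-MSCRA algorithm (defined in the context) for data $b=A\overline{x}+\varepsilon$. Let $\widehat{\varepsilon}:=\frac1nA^{\mathbb{T}}\varepsilon$ and $\Delta:=\{i:\|\overline{x}_{\mathcal{J}_i}\|\le 2\phi_-'(1)/\rho\}$. Suppose that $A$ has the RSC of constant $\kappa$ over $\mathcal{C}(\overline{S},1.5\overline{r})$. If the parameters $\nu$ and $\rho$ are chosen such that $$\frac{\sqrt3(4-2\overline{t}_\phi)(1-t_\phi^* )}{(3-\overline{t}_\phi)\kappa}\le\nu\le\frac{1-\overline{t}_\phi}{(3-\overline{t}_\phi)\|\mathcal{G}(\widehat{\varepsilon})\|_\infty},\qquad \frac{\nu(3-\overline{t}_\phi)\|\mathcal{G}(\widehat{\varepsilon})\|_\infty}{1-\overline{t}_\phi}\le\rho\le\sqrt{\frac{(3-\overline{t}_\phi)\kappa\nu}{\sqrt3(4-2\overline{t}_\phi)(1-t_\phi^* )}},$$ then for each $k\in\mathbb{N}$ (i.e. $k=1,2,\dots$) $$\|x^k-\overline{x}\|\le\frac{\sqrt3\,\|[\mathcal{G}(\widehat{\varepsilon})]_{\overline{S}}\|}{\kappa(\sqrt3-1)}+\frac{\sqrt3\,\rho}{\kappa(\sqrt3-1)\nu}\sqrt{\sum_{i\in\overline{S}}\mathbb{I}_\Delta(i)}+\Big(\frac{1}{\sqrt3}\Big)^{k-1}\|x^1-\overline{x}\|.$$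
   Context: $\mathcal{J}_1,\dots,\mathcal{J}_m$ are pairwise disjoint index sets with union $\{1,\dots,p\}$; $x_{\mathcal{J}_i}$ is the subvector of $x\in\mathbb{R}^p$ indexed by $\mathcal{J}_i$; $\|\cdot\|$ is the Euclidean norm; $\mathcal{G}(x):=(\|x_{\mathcal{J}_1}\|,\dots,\|x_{\mathcal{J}_m}\|)^{\mathbb{T}}$, and $[\mathcal{G}(x)]_S$ is the subvector with indices in $S$. $\mathbb{I}_F(i)=1$ if $i\in F$ and $0$ otherwise. $A\in\mathbb{R}^{n\times p}$, $\overline{x}\in\mathbb{R}^p$ is the true vector, $\varepsilon\in\mathbb{R}^n$ the noise, $b=A\overline{x}+\varepsilon$. $\Omega:=\{x\in\mathbb{R}^p:\|x\|_\infty\le R\}$ for a given $R>0$. $\overline{S}:=\{i:\overline{x}_{\mathcal{J}_i}\ne0\}$, $\overline{r}:=|\overline{S}|$. $L_f$ is the Lipschitz constant of $f(x):=\frac1{2n}\|Ax-b\|^2$ relative to $\Omega$. $\Phi$ is the family of closed proper convex functions $\phi:\mathbb{R}\to(-\infty,+\infty]$ with $[0,1]\subseteq\mathrm{int}(\mathrm{dom}\,\phi)$, $\phi(1)=1$, and $\phi(t_\phi^* )=0$, where $t_\phi^*$ is the unique minimizer of $\phi$ over $[0,1]$. $\overline{t}_\phi$ is the minimum element of $[t_\phi^*,1)$ such that $\frac{1}{1-t_\phi^*}\in\partial\phi(\overline{t}_\phi)$ (it exists); $\phi_-'$ is the left derivative. For $l>0$, $\mathcal{C}(\overline{S},l)$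 is the set of $z\in\mathbb{R}^p$ for which there is $S\supseteq\overline{S}$ (subset of $\{1,\dots,m\}$) with $|S|\le l$ and $\sum_{i\in S^c}\|z_{\mathcal{J}_i}\|\le\frac{2}{1-\overline{t}_\phi}\sum_{i\in S}\|z_{\mathcal{J}_i}\|$. $A$ has the RSC of constant $\kappa>0$ over a set $\mathcal{C}$ if $\frac{1}{2n}\|Ax\|^2\ge\kappa\|x\|^2$ for all $x\in\mathcal{C}$. GEP-MSCRA: choose $\phi\in\Phi$, $\nu>0$ and $w^0$ with $0\le w^0_i\le\overline{t}_\phi$ for all $i$; set $\lambda^0=\nu^{-1}$. For $k=1,2,\dots$: compute $$x^k\in\arg\min_{x\in\Omega}\Big\{\tfrac{1}{2n}\|Ax-b\|^2+\lambda^{k-1}\sum_{i=1}^m(1-w_i^{k-1})\|x_{\mathcal{J}_i}\|\Big\};$$ after $x^1$ is computed, select (using the information of $x^1$) a suitable $\rho>\overline{\rho}:=\nu L_f\frac{(1-t_\phi^* )\phi_-'(1)}{1-\overline{t}_\phi}$ and set $\lambda^k=\rho\nu^{-1}$ for $k\ge1$; then take $$w_i^k\in\arg\min_{t\in[0,1]}\{\phi(t)-\rho t\|x^k_{\mathcal{J}_i}\|\},\quad i=1,\dots,m.$$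
   Formalization: The formal theorem additionally assumes that the true vector lies in Ω, i.e. ‖x̄‖_∞ ≤ R; without this the stated error bound can fail, because an infeasible true vector can drive later iterates to a far point in a wrong group. *)

theory Defs
  imports "HOL-Analysis.Analysis"
begin

section \<open>Extended-real convex functions on the line and the family \<open>\<Phi>\<close>\<close>

definition epi :: "(real \<Rightarrow> ereal) \<Rightarrow> (real \<times> real) set"
  where "epi \<phi> = {(t, r). \<phi> t \<le> ereal r}"

definition dom_fn :: "(real \<Rightarrow> ereal) \<Rightarrow> real set"
  where "dom_fn \<phi> = {t. \<phi> t < \<infinity>}"

definition closed_proper_convex :: "(real \<Rightarrow> ereal) \<Rightarrow> bool"
  where "closed_proper_convex \<phi> \<longleftrightarrow>
    closed (epi \<phi>) \<and> convex (epi \<phi>) \<and> (\<forall>t. \<phi> t \<noteq> -\<infinity>) \<and> dom_fn \<phi> \<noteq> {}"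

definition subdiff :: "(real \<Rightarrow> ereal) \<Rightarrow> real \<Rightarrow> real set"
  where "subdiff \<phi> t = {s. \<forall>u. \<phi> t + ereal (s * (u - t)) \<le> \<phi> u}"

text \<open>
  The left derivative is only used at points in the interior of the effective domain;
  \<open>real_of_ereal\<close> agrees with the finite values of \<open>\<phi>\<close> near such a point.
\<close>
definition left_deriv :: "(real \<Rightarrow> ereal) \<Rightarrow> real \<Rightarrow> real"
  where "left_deriv \<phi> t =
    (THE d. ((\<lambda>u. real_of_ereal (\<phi> u)) has_real_derivative d) (at_left t))"

definition t_star :: "(real \<Rightarrow> ereal) \<Rightarrow> real"
  where "t_star \<phi> = (THE t. is_arg_min \<phi> (\<lambda>u. u \<in> {0..1}) t)"

definition Phi :: "(real \<Rightarrow> ereal) set"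
  where "Phi = {\<phi>. closed_proper_convex \<phi> \<and> {0..1} \<subseteq> interior (dom_fn \<phi>) \<and> \<phi> 1 = 1 \<and>
    (\<exists>!t. is_arg_min \<phi> (\<lambda>u. u \<in> {0..1}) t) \<and> \<phi> (t_star \<phi>) = 0}"

text \<open>
  For \<open>\<phi> \<in> Phi\<close> the minimum exists: \<open>1 / (1 - t_star \<phi>)\<close> is the slope of the chord of \<open>\<phi>\<close>
  over \<open>[t_star \<phi>, 1]\<close>, because \<open>\<phi> (t_star \<phi>) = 0\<close> and \<open>\<phi> 1 = 1\<close>.
\<close>
definition t_bar :: "(real \<Rightarrow> ereal) \<Rightarrow> real"
  where "t_bar \<phi> = (LEAST t. t \<in> {t_star \<phi>..<1} \<and> 1 / (1 - t_star \<phi>) \<in> subdiff \<phi> t)"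

section \<open>Group structure\<close>

text \<open>
  Coordinates are indexed by \<open>'p\<close> and groups by \<open>'m\<close>. The Euclidean norm of the subvector
  \<open>x\<^sub>S\<close> is \<open>L2_set (($) x) S\<close>.
\<close>

definition is_group_partition :: "('m::finite \<Rightarrow> 'p::finite set) \<Rightarrow> bool"
  where "is_group_partition J \<longleftrightarrow> disjoint_family J \<and> (\<Union>i. J i) = UNIV"

definition Gmap :: "('m::finite \<Rightarrow> 'p::finite set) \<Rightarrow> real^'p \<Rightarrow> real^'m"
  where "Gmap J x = (\<chi> i. L2_set (($) x) (J i))"

definition group_supp :: "('m::finite \<Rightarrow> 'p::finite set) \<Rightarrow> real^'p \<Rightarrow> 'm set"
  where "group_supp J x = {i. \<exists>j\<in>J i. x $ j \<noteq> 0}"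

definition cone_C ::
    "('m::finite \<Rightarrow> 'p::finite set) \<Rightarrow> (real \<Rightarrow> ereal) \<Rightarrow> 'm set \<Rightarrow> real \<Rightarrow> (real^'p) set"
  where "cone_C J \<phi> S0 l = {z. \<exists>S. S0 \<subseteq> S \<and> real (card S) \<le> l \<and>
    (\<Sum>i\<in>-S. Gmap J z $ i) \<le> 2 / (1 - t_bar \<phi>) * (\<Sum>i\<in>S. Gmap J z $ i)}"

definition RSC :: "real^'p^'n \<Rightarrow> real \<Rightarrow> (real^'p) set \<Rightarrow> bool"
  where "RSC A \<kappa> C \<longleftrightarrow> \<kappa> > 0 \<and>
    (\<forall>x\<in>C. 1 / (2 * real CARD('n)) * (norm (A *v x))\<^sup>2 \<ge> \<kappa> * (norm x)\<^sup>2)"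

section \<open>The algorithm GEP-MSCRA\<close>

definition Omega :: "real \<Rightarrow> (real^'p) set"
  where "Omega R = {x. infnorm x \<le> R}"

definition ls_loss :: "real^'p^'n \<Rightarrow> real^'n \<Rightarrow> real^'p \<Rightarrow> real"
  where "ls_loss A b x = 1 / (2 * real CARD('n)) * (norm (A *v x - b))\<^sup>2"

definition lip_const :: "real^'p^'n \<Rightarrow> real^'n \<Rightarrow> real \<Rightarrow> real"
  where "lip_const A b R = Inf {L. L-lipschitz_on (Omega R) (ls_loss A b)}"

definition rho_bar :: "real^'p^'n \<Rightarrow> real^'n \<Rightarrow> real \<Rightarrow> (real \<Rightarrow> ereal) \<Rightarrow> real \<Rightarrow> real"
  where "rho_bar A b R \<phi> \<nu> =
    \<nu> * lip_const A b R * ((1 - t_star \<phi>) * left_deriv \<phi> 1 / (1 - t_bar \<phi>))"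

definition lam :: "real \<Rightarrow> real \<Rightarrow> nat \<Rightarrow> real"
  where "lam \<nu> \<rho> k = (if k = 0 then 1 / \<nu> else \<rho> / \<nu>)"

text \<open>
  \<open>gep_mscra A b J R \<phi> \<nu> \<rho> w x\<close> states that \<open>w 0, w 1, \<dots>\<close> and \<open>x 1, x 2, \<dots>\<close> form a run of the
  algorithm (\<open>x 0\<close> plays no role); each argmin may be resolved arbitrarily. As \<open>\<rho>\<close> is an arbitrary
  number above \<open>rho_bar\<close>, it may in particular have been selected depending on \<open>x 1\<close>.
\<close>
definition gep_mscra ::
    "real^'p^'n \<Rightarrow> real^'n \<Rightarrow> ('m::finite \<Rightarrow> 'p::finite set) \<Rightarrow> real \<Rightarrow> (real \<Rightarrow> ereal) \<Rightarrow> real \<Rightarrow> real \<Rightarrow>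
      (nat \<Rightarrow> real^'m) \<Rightarrow> (nat \<Rightarrow> real^'p) \<Rightarrow> bool"
  where "gep_mscra A b J R \<phi> \<nu> \<rho> w x \<longleftrightarrow>
    \<phi> \<in> Phi \<and> \<nu> > 0 \<and> (\<forall>i. 0 \<le> w 0 $ i \<and> w 0 $ i \<le> t_bar \<phi>) \<and>
    \<rho> > rho_bar A b R \<phi> \<nu> \<and>
    (\<forall>k\<ge>1. is_arg_min
        (\<lambda>u. ls_loss A b u + lam \<nu> \<rho> (k - 1) * (\<Sum>i\<in>UNIV. (1 - w (k - 1) $ i) * Gmap J u $ i))
        (\<lambda>u. u \<in> Omega R) (x k)) \<and>
    (\<forall>k\<ge>1. \<forall>i. is_arg_min (\<lambda>t. \<phi> t - ereal (\<rho> * t * Gmap J (x k) $ i))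
        (\<lambda>t. t \<in> {0..1}) (w k $ i))"

end

theory Submission
  imports Defs
begin

text \<open>
  Comparing the objective at \<open>x\<^sup>k\<close> and at the true vector bounds
  \<open>\<parallel>A(x\<^sup>k - xbar)\<parallel>\<^sup>2 / 2n\<close> by a noise term plus the weighted penalty of the error. Let \<open>S\<^sup>k\<close> be the
  true support together with the groups whose weight \<open>w\<^sub>i\<^sup>k\<close> exceeds \<open>t_bar\<close>. Off \<open>S\<^sup>k\<close> the penalty
  dominates the noise, so the next error lies in the cone as long as \<open>|S\<^sup>k| \<le> 1.5 rbar\<close>, and RSC applies.
  A group wrongly in \<open>S\<^sup>k\<close>, and equally a true group outside \<open>\<Delta>\<close> that is still penalised, has error at least
  \<open>1 / (\<rho> (1 - t_star))\<close> by the optimality of \<open>w\<^sub>i\<^sup>k\<close> and the convexity of \<open>\<phi>\<close>. Hence the Euclidean norm of the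
  previous error pays for these groups: this keeps \<open>|S\<^sup>k| \<le> 1.5 rbar\<close> and makes the error recursion a
  contraction with factor \<open>1 / sqrt 3\<close>.
\<close>

section \<open>Convex functions on the line\<close>

text \<open>Slopes of chords into \<open>x\<close> from the left increase with the other endpoint
  and stay below the slope of a chord to some \<open>z\<close> right of \<open>x\<close>. A bounded
  monotone function has its supremum as left limit.\<close>

lemma convex_on_has_left_derivative:
  fixes f :: "real \<Rightarrow> real"
  assumes f: "convex_on I f" and I: "open I" "x \<in> I"
  obtains d where "(f has_real_derivative d) (at_left x)"
    and "\<And>y. y \<in> I \<Longrightarrow> y < x \<Longrightarrow> (f y - f x) / (y - x) \<le> d"
proof -
  let ?q = "\<lambda>y. (f y - f x) / (y - x)"
  obtain e where e: "e > 0" "ball x e \<subseteq> I"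
    using I openE by blast
  define z where "z = x + e / 2"
  have z: "z \<in> I" "x < z"
    using e by (auto simp: z_def subset_eq dist_real_def)
  have mono: "?q a \<le> ?q b" if "a \<in> I" "b \<in> I" "b < x" "a \<le> b" for a b
    using convex_on_slope_le(2)[OF f \<open>a \<in> I\<close> \<open>x \<in> I\<close>, of b] that by (cases "a = b") auto
  have bnd: "?q b \<le> (f x - f z) / (x - z)" if "b \<in> I" "b < x" for b
    using convex_on_slope_le[OF f that(1) z(1) that(2) z(2)] by simp
  have lim: "(?q \<longlongrightarrow> Sup (?q ` ({..<x} \<inter> I))) (at x within ({..<x} \<inter> I))"
    by (rule Lim_left_bound[OF mono bnd])
  have "at x within ({..<x} \<inter> I) = at_left x"
    by (rule at_within_nhd[OF I(2) I(1)]) auto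
  then have "(f has_real_derivative Sup (?q ` ({..<x} \<inter> I))) (at_left x)"
    using lim by (simp add: has_field_derivative_iff)
  moreover have "?q y \<le> Sup (?q ` ({..<x} \<inter> I))" if "y \<in> I" "y < x" for y
    using that bnd by (intro cSup_upper bdd_aboveI2[where M = "(f x - f z) / (x - z)"]) auto
  ultimately show thesis using that by blast
qed

text \<open>Chord slopes through \<open>t\<close> are monotone, so the inequality at the endpoints
  \<open>a\<close> and \<open>b\<close> already controls the rest of \<open>I\<close> beyond
  them.\<close>

lemma convex_on_local_subgradient:
  fixes f :: "real \<Rightarrow> real"
  assumes f: "convex_on I f" and t: "t \<in> {a<..<b}" and ab: "{a..b} \<subseteq> I"
    and loc: "\<And>u. u \<in> {a..b} \<Longrightarrow> f t + s * (u - t) \<le> f u"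
    and u: "u \<in> I"
  shows "f t + s * (u - t) \<le> f u"
proof -
  have tI: "t \<in> I" using t ab by auto
  consider "u \<in> {a..b}" | "u < a" | "u > b" by force
  then show ?thesis
  proof cases
    case 1
    then show ?thesis by (rule loc)
  next
    case 2
    have aI: "a \<in> I" using t ab by auto
    have "(f u - f t) / (u - t) \<le> (f a - f t) / (a - t)"
      using convex_on_slope_le(2)[OF f u tI, of a] 2 t by auto
    also have "\<dots> \<le> s"
      using loc[of a] t by (simp add: field_simps)
    finally show ?thesis using 2 t by (simp add: field_simps)
  next
    case 3
    have bI: "b \<in> I" using t ab by auto
    have "s \<le> (f t - f b) / (t - b)"
      using loc[of b] t by (simp add: field_simps)
    also have "\<dots> \<le> (f t - f u) / (t - u)"
      using convex_on_slope_le(1)[OF f tI u, of b] 3 t by auto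
    finally show ?thesis using 3 t by (simp add: field_simps)
  qed
qed

text \<open>A mean value theorem for convex functions: the point is an interior minimiser of
  \<open>f\<close> minus the linear function with the slope of the chord. It supplies the existence
  behind \<open>t_bar\<close>.\<close>

lemma chord_slope_subgradient:
  fixes f :: "real \<Rightarrow> real"
  assumes f: "convex_on I f" and ab: "a < b" "{a..b} \<subseteq> I" and cont: "continuous_on {a..b} f"
  obtains t where "t \<in> {a<..<b}"
    and "\<And>u. u \<in> I \<Longrightarrow> f t + (f b - f a) / (b - a) * (u - t) \<le> f u"
proof -
  define s where "s = (f b - f a) / (b - a)"
  define h where "h u = f u - s * u" for u
  have hab: "h b = h a"
    using ab by (simp add: h_def s_def field_simps)
  have "continuous_on {a..b} h"
    unfolding h_def by (intro continuous_intros cont)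
  then obtain t0 where t0: "t0 \<in> {a..b}" "\<And>u. u \<in> {a..b} \<Longrightarrow> h t0 \<le> h u"
    using continuous_attains_inf[of "{a..b}" h] ab by auto
  have "\<exists>t\<in>{a<..<b}. \<forall>u\<in>{a..b}. h t \<le> h u"
  proof (cases "t0 \<in> {a<..<b}")
    case False
    then have h0: "h t0 = h a" using t0(1) hab by force
    \<comment> \<open>If the minimum sits at an endpoint, both endpoints are minimal since
      \<open>h b = h a\<close>, and by convexity so is the midpoint.\<close>
    define m where "m = (a + b) / 2"
    have m: "m \<in> {a<..<b}" using ab by (simp add: m_def)
    have "f m \<le> (1 / 2) * f a + (1 / 2) * f b"
      using convex_onD[OF f, of "1/2" a b] ab by (simp add: m_def field_simps subset_eq)
    then have "h m \<le> (h a + h b) / 2"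
      by (simp add: h_def m_def field_simps)
    then have "h m \<le> h t0" using hab h0 by simp
    then show ?thesis using t0(2) m by (meson order_trans)
  qed (use t0(2) in blast)
  then obtain t where t: "t \<in> {a<..<b}" "\<And>u. u \<in> {a..b} \<Longrightarrow> h t \<le> h u"
    by blast
  have "f t + s * (u - t) \<le> f u" if "u \<in> I" for u
    using t(2) by (intro convex_on_local_subgradient[OF f t(1) ab(2) _ that]) (auto simp: h_def algebra_simps)
  with t(1) show thesis using that unfolding s_def by blast
qed

section \<open>Functions of the family \<open>Phi\<close>\<close>

context
  fixes \<phi> :: "real \<Rightarrow> ereal" and f :: "real \<Rightarrow> real"
  assumes Phi: "\<phi> \<in> Phi"
  defines "f \<equiv> \<lambda>t. real_of_ereal (\<phi> t)"
begin

lemma dom_fn_finite: "t \<in> dom_fn \<phi> \<Longrightarrow> \<phi> t = ereal (f t)"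
  using Phi unfolding Phi_def closed_proper_convex_def dom_fn_def f_def
  by (cases "\<phi> t") auto

lemma unit_interval_dom: "{0..1} \<subseteq> interior (dom_fn \<phi>)" "{0..1} \<subseteq> dom_fn \<phi>"
  using Phi interior_subset unfolding Phi_def by blast+

lemma unit_interval_finite: "t \<in> {0..1} \<Longrightarrow> \<phi> t = ereal (f t)"
  using unit_interval_dom(2) dom_fn_finite by blast

lemma Phi_convex_on: "convex_on (dom_fn \<phi>) f"
proof -
  have conv: "convex (epi \<phi>)"
    using Phi by (auto simp: Phi_def closed_proper_convex_def)
  have key: "\<phi> ((1 - c) * u + c * v) \<le> ereal ((1 - c) * f u + c * f v)"
    if "u \<in> dom_fn \<phi>" "v \<in> dom_fn \<phi>" "0 \<le> c" "c \<le> 1" for u v c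
    using convexD[OF conv, of "(u, f u)" "(v, f v)" "1 - c" c] that dom_fn_finite
    by (auto simp: epi_def)
  have cd: "convex (dom_fn \<phi>)"
  proof (rule convexI)
    fix u v a b :: real
    assume uv: "u \<in> dom_fn \<phi>" "v \<in> dom_fn \<phi>" "0 \<le> a" "0 \<le> b" "a + b = 1"
    then have "a = 1 - b" by simp
    then have "\<phi> (a * u + b * v) \<le> ereal (a * f u + b * f v)"
      using key[of u v b] uv by (simp only: \<open>a = 1 - b\<close>)
    then show "a *\<^sub>R u + b *\<^sub>R v \<in> dom_fn \<phi>"
      unfolding dom_fn_def by (auto intro: le_less_trans)
  qed
  show ?thesis
  proof (rule convex_onI[OF _ cd])
    fix c u v :: real assume c: "0 < c" "c < 1" and uv: "u \<in> dom_fn \<phi>" "v \<in> dom_fn \<phi>"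
    have "(1 - c) *\<^sub>R u + c *\<^sub>R v \<in> dom_fn \<phi>"
      using c uv by (intro convexD[OF cd]) auto
    from dom_fn_finite[OF this] key[OF uv, of c] c
    show "f ((1 - c) *\<^sub>R u + c *\<^sub>R v) \<le> (1 - c) * f u + c * f v" by simp
  qed
qed

lemma Phi_continuous_on: "continuous_on (interior (dom_fn \<phi>)) f"
  using Phi_convex_on interior_subset
  by (intro convex_on_continuous open_interior)
    (blast intro: convex_on_subset convex_interior convex_on_imp_convex)

lemma t_star_arg_min: "is_arg_min \<phi> (\<lambda>u. u \<in> {0..1}) (t_star \<phi>)"
proof -
  have "\<exists>!t. is_arg_min \<phi> (\<lambda>u. u \<in> {0..1}) t"
    using Phi by (simp add: Phi_def)
  then show ?thesis unfolding t_star_def by (rule theI')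
qed

lemma t_star_facts: "0 \<le> t_star \<phi>" "t_star \<phi> < 1" "f (t_star \<phi>) = 0" "f 1 = 1"
proof -
  have "t_star \<phi> \<in> {0..1}"
    using t_star_arg_min unfolding is_arg_min_linorder by blast
  moreover have v: "\<phi> 1 = 1" "\<phi> (t_star \<phi>) = 0"
    using Phi by (auto simp: Phi_def)
  ultimately show "0 \<le> t_star \<phi>" "t_star \<phi> < 1"
    by (auto simp: order_less_le)
  show "f (t_star \<phi>) = 0" "f 1 = 1" using v by (simp_all add: f_def)
qed

lemma subdiff_iff:
  assumes "t \<in> dom_fn \<phi>"
  shows "s \<in> subdiff \<phi> t \<longleftrightarrow> (\<forall>u\<in>dom_fn \<phi>. f t + s * (u - t) \<le> f u)"
proof -
  have "\<phi> t + ereal (s * (u - t)) \<le> \<phi> u \<longleftrightarrow> (u \<in> dom_fn \<phi> \<longrightarrow> f t + s * (u - t) \<le> f u)" for u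
    using dom_fn_finite[OF assms] dom_fn_finite[of u] by (cases "u \<in> dom_fn \<phi>") (auto simp: dom_fn_def)
  then show ?thesis unfolding subdiff_def by blast
qed

text \<open>The \<open>LEAST\<close> in \<open>t_bar\<close> has these properties once a least
  candidate exists. \<open>chord_slope_subgradient\<close> yields one candidate
  \<open>t0 < 1\<close>, and the candidates up to it form a compact set.\<close>

lemma t_bar_facts:
  shows "t_star \<phi> \<le> t_bar \<phi>" "t_bar \<phi> < 1" "1 / (1 - t_star \<phi>) \<in> subdiff \<phi> (t_bar \<phi>)"
proof -
  let ?a = "t_star \<phi>" and ?s = "1 / (1 - t_star \<phi>)"
  have int: "{?a..1} \<subseteq> interior (dom_fn \<phi>)" "{?a..1} \<subseteq> dom_fn \<phi>"
    using unit_interval_dom t_star_facts by auto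
  have cont: "continuous_on {?a..1} f"
    using Phi_continuous_on int(1) continuous_on_subset by blast
  obtain t0 where t0: "t0 \<in> {?a<..<1}" "\<And>u. u \<in> dom_fn \<phi> \<Longrightarrow> f t0 + ?s * (u - t0) \<le> f u"
    using chord_slope_subgradient[OF Phi_convex_on t_star_facts(2) int(2) cont] t_star_facts by auto
  \<comment> \<open>Cutting at \<open>t0\<close> replaces a half-open interval by a compact one
    without losing the least candidate. \<open>T\<close> is closed, being an intersection of closed
    conditions, one for each \<open>u\<close>.\<close>
  define T where "T = {t \<in> {?a..t0}. ?s \<in> subdiff \<phi> t}"
  have T: "T = (\<Inter>u\<in>dom_fn \<phi>. {t \<in> {?a..t0}. f t + ?s * (u - t) \<le> f u})"
  proof -
    have "?s \<in> subdiff \<phi> t \<longleftrightarrow> (\<forall>u\<in>dom_fn \<phi>. f t + ?s * (u - t) \<le> f u)" if "t \<in> {?a..t0}" for t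
      using that int(2) t0(1) by (intro subdiff_iff) auto
    moreover have "1 \<in> dom_fn \<phi>" using unit_interval_dom by auto
    ultimately show ?thesis unfolding T_def by blast
  qed
  have "closed {t \<in> {?a..t0}. f t + ?s * (u - t) \<le> f u}" for u
    using t0(1) by (intro continuous_on_closed_Collect_le continuous_intros continuous_on_subset[OF cont]) auto
  then have "closed T" unfolding T by blast
  moreover have "bounded T"
    by (rule bounded_subset[of "{?a..t0}"]) (auto simp: T_def)
  ultimately have "compact T" by (simp add: compact_eq_bounded_closed)
  moreover have "t0 \<in> T"
  proof -
    have "t0 \<in> dom_fn \<phi>" using t0(1) int(2) by auto
    then show ?thesis using t0 by (simp add: T_def subdiff_iff)
  qed
  ultimately obtain m where m: "m \<in> T" "\<And>t. t \<in> T \<Longrightarrow> m \<le> t"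
    using compact_attains_inf[of T] by auto
  have "t_bar \<phi> = m"
    unfolding t_bar_def
  proof (rule Least_equality)
    show "m \<in> {?a..<1} \<and> ?s \<in> subdiff \<phi> m" using m(1) t0(1) by (auto simp: T_def)
  next
    fix t assume "t \<in> {?a..<1} \<and> ?s \<in> subdiff \<phi> t"
    then show "m \<le> t" using m t0(1) by (cases "t \<le> t0") (auto simp: T_def)
  qed
  then show "t_star \<phi> \<le> t_bar \<phi>" "t_bar \<phi> < 1" "?s \<in> subdiff \<phi> (t_bar \<phi>)"
    using m(1) t0(1) by (auto simp: T_def)
qed

text \<open>By convexity the left derivative dominates the slope of every chord ending at 1, where
  \<open>f 1 = 1\<close>; \<open>THE\<close> picks this derivative because limits are
  unique.\<close>

lemma left_deriv_ge_slope:
  assumes "u \<in> {0..<1}"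
  shows "1 - f u \<le> left_deriv \<phi> 1 * (1 - u)"
proof -
  let ?I = "interior (dom_fn \<phi>)"
  have "convex_on ?I f"
    using Phi_convex_on interior_subset
    by (blast intro: convex_on_subset convex_interior convex_on_imp_convex)
  moreover have "1 \<in> ?I" using unit_interval_dom(1) by auto
  ultimately obtain d where d: "(f has_real_derivative d) (at_left 1)"
    "\<And>y. y \<in> ?I \<Longrightarrow> y < 1 \<Longrightarrow> (f y - f 1) / (y - 1) \<le> d"
    using convex_on_has_left_derivative open_interior by blast
  have "left_deriv \<phi> 1 = d"
    unfolding left_deriv_def f_def[symmetric]
  proof (rule the_equality, rule d(1))
    fix d' assume "(f has_real_derivative d') (at_left 1)"
    then show "d' = d"
      using d(1) unfolding has_field_derivative_iff
      by (rule tendsto_unique[OF trivial_limit_at_left_real])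
  qed
  then show ?thesis
    using d(2)[of u] assms t_star_facts(4) subsetD[OF unit_interval_dom(1), of u]
    by (simp add: field_simps)
qed

text \<open>The chord from \<open>t_star\<close> to 1 rises from 0 to 1.\<close>

lemma left_deriv_ge: "1 / (1 - t_star \<phi>) \<le> left_deriv \<phi> 1"
  using left_deriv_ge_slope[of "t_star \<phi>"] t_star_facts by (simp add: field_simps)

section \<open>Weights as minimisers of \<open>\<phi>\<close> minus a linear function\<close>

context
  fixes c w :: real
  assumes w: "is_arg_min (\<lambda>t. \<phi> t - ereal (c * t)) (\<lambda>t. t \<in> {0..1}) w"
begin

lemma weight_range: "0 \<le> w" "w \<le> 1"
  using w unfolding is_arg_min_linorder by auto

lemma weight_minimal: "u \<in> {0..1} \<Longrightarrow> f w - c * w \<le> f u - c * u"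
  using w unit_interval_finite[of u] unit_interval_finite[of w] unfolding is_arg_min_linorder by fastforce

text \<open>The subgradient at \<open>t_bar\<close> makes \<open>f\<close> grow at rate at least
  \<open>1 / (1 - t_star \<phi>)\<close> on the way to \<open>w\<close>; minimality of
  \<open>w\<close> against \<open>t_bar\<close> requires the linear gain \<open>c\<close> to
  outweigh this.\<close>

lemma weight_gt_t_bar:
  assumes "t_bar \<phi> < w"
  shows "1 / (1 - t_star \<phi>) \<le> c"
proof -
  have tb: "t_bar \<phi> \<in> {0..1}" using t_bar_facts t_star_facts by auto
  have "f (t_bar \<phi>) + 1 / (1 - t_star \<phi>) * (w - t_bar \<phi>) \<le> f w"
    using t_bar_facts(3) tb weight_range unit_interval_dom(2) by (auto simp: subdiff_iff subset_eq)
  with weight_minimal[OF tb] have "1 / (1 - t_star \<phi>) * (w - t_bar \<phi>) \<le> c * (w - t_bar \<phi>)"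
    by (simp add: algebra_simps)
  then show ?thesis using assms by (metis diff_gt_0_iff_gt mult_right_le_imp_le)
qed

text \<open>Moving from \<open>w\<close> to 1 costs at most \<open>left_deriv \<phi> 1\<close> per
  unit of length, and minimality of \<open>w\<close> against 1 says that the gain \<open>c\<close>
  does not exceed the cost.\<close>

lemma weight_less_1:
  assumes "w < 1"
  shows "c \<le> left_deriv \<phi> 1"
proof -
  have "1 - f w \<le> left_deriv \<phi> 1 * (1 - w)"
    using left_deriv_ge_slope weight_range assms by simp
  moreover have "c * (1 - w) \<le> 1 - f w"
    using weight_minimal[of 1] t_star_facts(4) by (simp add: algebra_simps)
  ultimately have "c * (1 - w) \<le> left_deriv \<phi> 1 * (1 - w)" by linarith
  then show ?thesis using assms by (metis diff_gt_0_iff_gt mult_right_le_imp_le)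
qed

end

end

section \<open>Groups and the least-squares loss\<close>

lemma Gmap_nonneg [simp]: "0 \<le> Gmap J x $ i"
  by (simp add: Gmap_def)

lemma Gmap_triangle: "Gmap J (x + y) $ i \<le> Gmap J x $ i + Gmap J y $ i"
  using L2_set_triangle_ineq[of "($) x" "($) y" "J i"] by (simp add: Gmap_def L2_set_def)

lemma Gmap_minus_commute: "Gmap J (x - y) $ i = Gmap J (y - x) $ i"
  by (simp add: Gmap_def L2_set_def power2_commute)

lemma Gmap_diff_le: "Gmap J x $ i - Gmap J y $ i \<le> Gmap J (x - y) $ i"
  using Gmap_triangle[of J "x - y" y i] by simp

lemma Gmap_eq_0: "i \<notin> group_supp J x \<Longrightarrow> Gmap J x $ i = 0"
  by (auto simp: group_supp_def Gmap_def intro: L2_set_0')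

lemma sum_group_partition:
  assumes "is_group_partition J"
  shows "(\<Sum>j\<in>UNIV. h j) = (\<Sum>i\<in>UNIV. \<Sum>j\<in>J i. h j)"
proof -
  have "(\<Sum>j\<in>(\<Union>i\<in>UNIV. J i). h j) = (\<Sum>i\<in>UNIV. \<Sum>j\<in>J i. h j)"
    using assms by (intro sum.UNION_disjoint) (auto simp: is_group_partition_def disjoint_family_on_def)
  then show ?thesis using assms by (simp add: is_group_partition_def)
qed

lemma norm_eq_L2_set_Gmap:
  assumes "is_group_partition J"
  shows "norm z = L2_set (($) (Gmap J z)) UNIV"
proof -
  have "(\<Sum>j\<in>UNIV. (z $ j)\<^sup>2) = (\<Sum>i\<in>UNIV. (Gmap J z $ i)\<^sup>2)"
    unfolding sum_group_partition[OF assms] by (simp add: Gmap_def L2_set_def sum_nonneg)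
  then show ?thesis by (simp add: norm_vec_def L2_set_def)
qed

lemma inner_le_sum_Gmap:
  assumes "is_group_partition J"
  shows "x \<bullet> z \<le> (\<Sum>i\<in>UNIV. Gmap J x $ i * Gmap J z $ i)"
proof -
  have "x \<bullet> z = (\<Sum>i\<in>UNIV. \<Sum>j\<in>J i. x $ j * z $ j)"
    by (simp add: inner_vec_def sum_group_partition[OF assms])
  also have "\<dots> \<le> (\<Sum>i\<in>UNIV. \<Sum>j\<in>J i. \<bar>x $ j\<bar> * \<bar>z $ j\<bar>)"
    by (intro sum_mono) (simp flip: abs_mult)
  also have "\<dots> \<le> (\<Sum>i\<in>UNIV. Gmap J x $ i * Gmap J z $ i)"
    unfolding Gmap_def by (intro sum_mono) (simp add: L2_set_mult_ineq)
  finally show ?thesis .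
qed

text \<open>Cauchy-Schwarz over the groups, followed by enlarging \<open>S\<close> to all groups in
  the second factor.\<close>

lemma sum_mult_Gmap_le:
  assumes "is_group_partition J"
  shows "(\<Sum>i\<in>S. a i * Gmap J z $ i) \<le> L2_set a S * norm z"
proof -
  have "(\<Sum>i\<in>S. a i * Gmap J z $ i) \<le> (\<Sum>i\<in>S. \<bar>a i\<bar> * \<bar>Gmap J z $ i\<bar>)"
    by (intro sum_mono) (simp add: mult_right_mono)
  also have "\<dots> \<le> L2_set a S * L2_set (($) (Gmap J z)) S"
    by (rule L2_set_mult_ineq)
  also have "\<dots> \<le> L2_set a S * norm z"
    unfolding norm_eq_L2_set_Gmap[OF assms] L2_set_def
    by (intro mult_left_mono real_sqrt_le_mono sum_mono2) (auto simp: sum_nonneg)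
  finally show ?thesis .
qed

text \<open>\<open>Inf\<close> of an empty set of reals carries no information, so some Lipschitz
  constant is exhibited: the residual norm is bounded and Lipschitz on \<open>Omega R\<close>, hence
  so is its square. This makes \<open>rho_bar\<close> nonnegative.\<close>

lemma lip_const_nonneg:
  fixes A :: "real^'p^'n"
  shows "0 \<le> lip_const A b R"
proof -
  obtain K where K: "K > 0" "\<And>u. norm (A *v u) \<le> K * norm u"
    using bounded_linear.pos_bounded[OF matrix_vector_mul_bounded_linear[of A]] by (metis mult.commute)
  define M where "M = K * (sqrt DIM(real^'p) * \<bar>R\<bar>) + norm b"
  define c where "c = 1 / (2 * real CARD('n))"
  have M: "norm (A *v u - b) \<le> M" if "u \<in> Omega R" for u :: "real^'p"
  proof -
    have "infnorm u \<le> \<bar>R\<bar>" using that by (simp add: Omega_def)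
    then have "sqrt DIM(real^'p) * infnorm u \<le> sqrt DIM(real^'p) * \<bar>R\<bar>"
      by (intro mult_left_mono) auto
    then have "norm u \<le> sqrt DIM(real^'p) * \<bar>R\<bar>"
      using norm_le_infnorm[of u] by linarith
    then have "norm (A *v u) \<le> K * (sqrt DIM(real^'p) * \<bar>R\<bar>)"
      using K by (meson mult_left_mono order_trans less_imp_le)
    then show ?thesis using norm_triangle_ineq4[of "A *v u" b] by (simp add: M_def)
  qed
  have M0: "0 \<le> M" using K(1) by (simp add: M_def)
  have c0: "0 \<le> c" by (simp add: c_def)
  have "(c * (K * (2 * M)))-lipschitz_on (Omega R) (ls_loss A b)"
  proof (rule lipschitz_onI)
    fix u v :: "real^'p" assume uv: "u \<in> Omega R" "v \<in> Omega R"
    let ?p = "norm (A *v u - b)" and ?q = "norm (A *v v - b)"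
    have "\<bar>?p - ?q\<bar> \<le> norm (A *v (u - v))"
      using norm_triangle_ineq3[of "A *v u - b" "A *v v - b"] by (simp add: matrix_vector_mult_diff_distrib)
    also have "\<dots> \<le> K * norm (u - v)" by (rule K(2))
    finally have pq: "\<bar>?p - ?q\<bar> \<le> K * norm (u - v)" .
    have "\<bar>?p\<^sup>2 - ?q\<^sup>2\<bar> = \<bar>?p - ?q\<bar> * (?p + ?q)"
      by (simp add: power2_eq_square square_diff_square_factored abs_mult)
    also have "\<dots> \<le> (K * norm (u - v)) * (2 * M)"
      using pq M[OF uv(1)] M[OF uv(2)] by (intro mult_mono) auto
    finally have "c * \<bar>?p\<^sup>2 - ?q\<^sup>2\<bar> \<le> c * ((K * norm (u - v)) * (2 * M))"
      using c0 by (rule mult_left_mono)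
    moreover have "dist (ls_loss A b u) (ls_loss A b v) = c * \<bar>?p\<^sup>2 - ?q\<^sup>2\<bar>"
      using c0 unfolding ls_loss_def c_def[symmetric] dist_real_def
      by (simp add: abs_mult flip: right_diff_distrib)
    ultimately show "dist (ls_loss A b u) (ls_loss A b v) \<le> c * (K * (2 * M)) * dist u v"
      by (simp add: dist_norm mult_ac)
  qed (use K M0 c0 in auto)
  then show ?thesis
    unfolding lip_const_def by (intro cInf_greatest) (auto dest: lipschitz_on_nonneg)
qed

lemma ls_loss_difference:
  fixes A :: "real^'p^'n"
  assumes b: "b = A *v y + \<epsilon>"
  shows "ls_loss A b x - ls_loss A b y =
    1 / (2 * real CARD('n)) * (norm (A *v (x - y)))\<^sup>2 -
    ((1 / real CARD('n)) *\<^sub>R (transpose A *v \<epsilon>)) \<bullet> (x - y)"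
proof -
  let ?u = "A *v (x - y)"
  have "A *v x - b = ?u - \<epsilon>" "A *v y - b = - \<epsilon>"
    using b by (simp_all add: matrix_vector_mult_diff_distrib)
  moreover have "(transpose A *v \<epsilon>) \<bullet> (x - y) = \<epsilon> \<bullet> ?u"
    by (simp add: dot_lmul_matrix)
  moreover have "(norm (?u - \<epsilon>))\<^sup>2 = (norm ?u)\<^sup>2 - 2 * (\<epsilon> \<bullet> ?u) + (norm \<epsilon>)\<^sup>2"
    by (simp add: power2_norm_eq_inner inner_diff_left inner_diff_right inner_commute)
  ultimately show ?thesis
    unfolding ls_loss_def \<open>A *v x - b = ?u - \<epsilon>\<close> \<open>A *v y - b = - \<epsilon>\<close>
    by (simp add: field_simps)
qed

text \<open>
  Only minimality against the true vector is used; this costs a factor 2 compared with the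
  first-order optimality condition.
\<close>
lemma basic_inequality:
  fixes A :: "real^'p^'n" and J :: "'m::finite \<Rightarrow> 'p::finite set" and x y :: "real^'p" and \<epsilon> :: "real^'n"
  defines "z \<equiv> x - y" and "eh \<equiv> (1 / real CARD('n)) *\<^sub>R (transpose A *v \<epsilon>)"
    and "S0 \<equiv> group_supp J y"
  assumes J: "is_group_partition J" and b: "b = A *v y + \<epsilon>"
    and min: "ls_loss A b x + l * (\<Sum>i\<in>UNIV. v i * Gmap J x $ i)
      \<le> ls_loss A b y + l * (\<Sum>i\<in>UNIV. v i * Gmap J y $ i)"
    and l: "0 \<le> l" and v: "\<And>i. 0 \<le> v i"
  shows "1 / (2 * real CARD('n)) * (norm (A *v z))\<^sup>2 \<le>
    (\<Sum>i\<in>UNIV. Gmap J eh $ i * Gmap J z $ i) +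
    l * ((\<Sum>i\<in>S0. v i * Gmap J z $ i) - (\<Sum>i\<in>-S0. v i * Gmap J z $ i))"
proof -
  \<comment> \<open>On the support only the reverse triangle inequality is available; off it
    \<open>y\<close> vanishes, so the penalty of \<open>x\<close> is that of the error and enters
    with a negative sign.\<close>
  have on: "v i * Gmap J y $ i - v i * Gmap J x $ i \<le> v i * Gmap J z $ i" for i
    using mult_left_mono[OF Gmap_diff_le[of J y i x] v[of i]] Gmap_minus_commute[of J y x]
    by (simp add: z_def right_diff_distrib)
  have off: "v i * Gmap J y $ i - v i * Gmap J x $ i \<le> - (v i * Gmap J z $ i)" if "i \<in> - S0" for i
  proof -
    have "Gmap J y $ i = 0" using that Gmap_eq_0 by (simp add: S0_def)
    moreover have "Gmap J z $ i \<le> Gmap J x $ i"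
      using Gmap_diff_le[of J z i x] Gmap_minus_commute[of J z x] calculation
      by (simp add: z_def Gmap_def L2_set_def)
    ultimately show ?thesis using v[of i] by (simp add: mult_left_mono)
  qed
  have "(\<Sum>i\<in>UNIV. v i * Gmap J y $ i) - (\<Sum>i\<in>UNIV. v i * Gmap J x $ i)
      = (\<Sum>i\<in>S0. v i * Gmap J y $ i - v i * Gmap J x $ i)
      + (\<Sum>i\<in>-S0. v i * Gmap J y $ i - v i * Gmap J x $ i)"
    using sum.union_disjoint[of S0 "-S0" "\<lambda>i. v i * Gmap J y $ i - v i * Gmap J x $ i"]
    by (simp add: Compl_partition sum_subtractf)
  also have "\<dots> \<le> (\<Sum>i\<in>S0. v i * Gmap J z $ i) + (\<Sum>i\<in>-S0. - (v i * Gmap J z $ i))"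
    by (intro add_mono sum_mono on off)
  finally have "l * ((\<Sum>i\<in>UNIV. v i * Gmap J y $ i) - (\<Sum>i\<in>UNIV. v i * Gmap J x $ i))
      \<le> l * ((\<Sum>i\<in>S0. v i * Gmap J z $ i) - (\<Sum>i\<in>-S0. v i * Gmap J z $ i))"
    using l by (intro mult_left_mono) (simp_all add: sum_negf)
  moreover have "eh \<bullet> z \<le> (\<Sum>i\<in>UNIV. Gmap J eh $ i * Gmap J z $ i)"
    by (rule inner_le_sum_Gmap[OF J])
  ultimately show ?thesis
    using min ls_loss_difference[OF b, of x] unfolding z_def eh_def by (simp add: right_diff_distrib)
qed

section \<open>Error bounds for one step\<close>

text \<open>The constant is the largest possible coefficient: the full penalty \<open>l\<close> plus
  the highest admissible noise level \<open>l * (1 - t) / (3 - t)\<close>.\<close>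

lemma weighted_sum_le:
  fixes g a v :: "'m::finite \<Rightarrow> real" and t :: real
  assumes S: "S0 \<subseteq> S" and t: "t < 1" and l: "0 < l"
    and e: "\<And>i. a i \<le> e" "(3 - t) * e \<le> l * (1 - t)"
    and v: "\<And>i. v i \<le> 1" and g: "\<And>i. 0 \<le> g i"
  shows "(\<Sum>i\<in>S0. (a i + l * v i) * g i) + (\<Sum>i\<in>S - S0. e * g i)
    \<le> l * (4 - 2 * t) / (3 - t) * (\<Sum>i\<in>S. g i)"
proof -
  define D where "D = l * (4 - 2 * t) / (3 - t)"
  have "e \<le> l * (1 - t) / (3 - t)" using e(2) t by (simp add: field_simps)
  moreover have "l * (1 - t) / (3 - t) + l = D" using t by (simp add: D_def field_simps)
  ultimately have "e + l \<le> D" by linarith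
  moreover have "l * v i \<le> l" for i using v[of i] l by simp
  ultimately have D: "a i + l * v i \<le> D" "e \<le> D" for i
    using e(1)[of i] l by (smt (verit))+
  have "(\<Sum>i\<in>S0. (a i + l * v i) * g i) + (\<Sum>i\<in>S - S0. e * g i)
      \<le> (\<Sum>i\<in>S0. D * g i) + (\<Sum>i\<in>S - S0. D * g i)"
    using D g by (intro add_mono sum_mono mult_right_mono) auto
  also have "\<dots> = D * (\<Sum>i\<in>S. g i)"
    using sum.subset_diff[OF S, of "\<lambda>i. D * g i"] by (simp add: sum_distrib_left)
  finally show ?thesis by (simp add: D_def)
qed

text \<open>Outside \<open>S\<close> the penalty is at least \<open>l * (1 - t_bar \<phi>)\<close>
  and beats the noise, so those groups move to the left side with a positive coefficient. This puts
  \<open>z\<close> into the cone, and RSC turns the bound on \<open>A *v z\<close> into one on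
  \<open>z\<close>.\<close>

lemma restricted_basic_bound:
  fixes A :: "real^'p^'n" and J :: "'m::finite \<Rightarrow> 'p::finite set" and a v :: "'m \<Rightarrow> real"
  assumes J: "is_group_partition J"
    and rsc: "RSC A \<kappa> (cone_C J \<phi> S0 r)"
    and tb: "t_bar \<phi> < 1"
    and S: "S0 \<subseteq> S" "real (card S) \<le> r"
    and l: "0 < l" and e: "\<And>i. a i \<le> e" "(3 - t_bar \<phi>) * e \<le> l * (1 - t_bar \<phi>)"
    and v: "\<And>i. 0 \<le> v i" "\<And>i. v i \<le> 1" "\<And>i. i \<notin> S \<Longrightarrow> 1 - t_bar \<phi> \<le> v i"
    and basic: "1 / (2 * real CARD('n)) * (norm (A *v z))\<^sup>2 \<le>
      (\<Sum>i\<in>UNIV. a i * Gmap J z $ i) +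
      l * ((\<Sum>i\<in>S0. v i * Gmap J z $ i) - (\<Sum>i\<in>-S0. v i * Gmap J z $ i))"
  shows "\<kappa> * (norm z)\<^sup>2 \<le> (\<Sum>i\<in>S0. (a i + l * v i) * Gmap J z $ i) + (\<Sum>i\<in>S - S0. e * Gmap J z $ i)"
proof -
  let ?g = "\<lambda>i. Gmap J z $ i" and ?t = "t_bar \<phi>"
  let ?Q = "1 / (2 * real CARD('n)) * (norm (A *v z))\<^sup>2"
  have el: "e \<le> l * (1 - ?t) / (3 - ?t)"
    using e(2) tb by (simp add: field_simps)
  have UNIV_split: "(\<Sum>i\<in>UNIV. h i) = (\<Sum>i\<in>S0. h i) + (\<Sum>i\<in>S - S0. h i) + (\<Sum>i\<in>-S. h i)" for h :: "'m \<Rightarrow> real"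
  proof -
    have "(\<Sum>i\<in>UNIV. h i) = (\<Sum>i\<in>S. h i) + (\<Sum>i\<in>-S. h i)"
      using sum.union_disjoint[of S "-S" h] by (simp add: Compl_partition)
    then show ?thesis using sum.subset_diff[OF S(1), of h] by simp
  qed
  have Compl_split: "(\<Sum>i\<in>-S0. h i) = (\<Sum>i\<in>S - S0. h i) + (\<Sum>i\<in>-S. h i)" for h :: "'m \<Rightarrow> real"
  proof -
    have "- S0 = (S - S0) \<union> (- S)" using S(1) by blast
    moreover have "sum h ((S - S0) \<union> (- S)) = sum h (S - S0) + sum h (- S)"
      by (rule sum.union_disjoint) auto
    ultimately show ?thesis by simp
  qed
  \<comment> \<open>On \<open>S - S0\<close> the weights may be small, so the penalty is dropped by
    its sign and only the noise remains.\<close>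
  have mid: "a i * ?g i - l * (v i * ?g i) \<le> e * ?g i" for i
  proof -
    have "a i * ?g i \<le> e * ?g i" using e(1) by (simp add: mult_right_mono)
    moreover have "0 \<le> l * (v i * ?g i)" using l v(1) by simp
    ultimately show ?thesis by linarith
  qed
  have off: "a i * ?g i - l * (v i * ?g i) \<le> - (l * (1 - ?t) * (2 - ?t) / (3 - ?t)) * ?g i"
    if "i \<in> -S" for i
  proof -
    have "a i - l * v i \<le> l * (1 - ?t) / (3 - ?t) - l * (1 - ?t)"
    proof -
      have "l * (1 - ?t) \<le> l * v i" using v(3)[of i] l that by (intro mult_left_mono) auto
      then show ?thesis using el e(1)[of i] by linarith
    qed
    also have "\<dots> = - (l * (1 - ?t) * (2 - ?t) / (3 - ?t))"
      using tb by (simp add: field_simps)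
    finally have "(a i - l * v i) * ?g i \<le> - (l * (1 - ?t) * (2 - ?t) / (3 - ?t)) * ?g i"
      by (rule mult_right_mono) simp
    then show ?thesis by (simp add: algebra_simps)
  qed
  have "?Q \<le> (\<Sum>i\<in>S0. (a i + l * v i) * ?g i) + (\<Sum>i\<in>S - S0. a i * ?g i - l * (v i * ?g i))
      + (\<Sum>i\<in>-S. a i * ?g i - l * (v i * ?g i))"
    using basic unfolding UNIV_split Compl_split
    by (simp add: sum.distrib sum_subtractf sum_distrib_left algebra_simps)
  also have "\<dots> \<le> (\<Sum>i\<in>S0. (a i + l * v i) * ?g i) + (\<Sum>i\<in>S - S0. e * ?g i)
      + (\<Sum>i\<in>-S. - (l * (1 - ?t) * (2 - ?t) / (3 - ?t)) * ?g i)"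
    by (intro add_mono sum_mono mid off order_refl)
  finally have main: "?Q + l * (1 - ?t) * (2 - ?t) / (3 - ?t) * (\<Sum>i\<in>-S. ?g i)
      \<le> (\<Sum>i\<in>S0. (a i + l * v i) * ?g i) + (\<Sum>i\<in>S - S0. e * ?g i)"
    unfolding sum_distrib_left[symmetric] by linarith
  have up: "(\<Sum>i\<in>S0. (a i + l * v i) * ?g i) + (\<Sum>i\<in>S - S0. e * ?g i)
      \<le> l * (4 - 2 * ?t) / (3 - ?t) * (\<Sum>i\<in>S. ?g i)"
    using S(1) tb l e v(2) by (intro weighted_sum_le) auto
  have "0 \<le> ?Q" by simp
  with main up have cone: "l * (1 - ?t) * (2 - ?t) / (3 - ?t) * (\<Sum>i\<in>-S. ?g i) \<le> l * (4 - 2 * ?t) / (3 - ?t) * (\<Sum>i\<in>S. ?g i)"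
    by linarith
  \<comment> \<open>Since \<open>4 - 2 * ?t = 2 * (2 - ?t)\<close>, both constants share the factor
    \<open>c\<close>; cancelling it leaves exactly the ratio \<open>2 / (1 - ?t)\<close> that
    defines the cone.\<close>
  define c where "c = l * (2 - ?t) / (3 - ?t)"
  have c: "c > 0" using l tb by (simp add: c_def)
  have "c * ((1 - ?t) * (\<Sum>i\<in>-S. ?g i)) \<le> c * (2 * (\<Sum>i\<in>S. ?g i))"
  proof -
    have "l * (1 - ?t) * (2 - ?t) / (3 - ?t) = c * (1 - ?t)" "l * (4 - 2 * ?t) / (3 - ?t) = c * 2"
      using tb by (simp_all add: c_def field_simps)
    then show ?thesis using cone by (simp only: mult.assoc)
  qed
  then have "(1 - ?t) * (\<Sum>i\<in>-S. ?g i) \<le> 2 * (\<Sum>i\<in>S. ?g i)"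
    using c by simp
  then have "(\<Sum>i\<in>-S. ?g i) \<le> 2 / (1 - ?t) * (\<Sum>i\<in>S. ?g i)"
    using tb by (simp add: field_simps)
  then have "z \<in> cone_C J \<phi> S0 r"
    using S unfolding cone_C_def by blast
  then have "\<kappa> * (norm z)\<^sup>2 \<le> ?Q" using rsc by (simp add: RSC_def)
  moreover have "0 \<le> l * (1 - ?t) * (2 - ?t) / (3 - ?t) * (\<Sum>i\<in>-S. ?g i)"
    using l tb by (intro mult_nonneg_nonneg divide_nonneg_nonneg sum_nonneg) auto
  ultimately show ?thesis using main by linarith
qed

context
  fixes J :: "'m::finite \<Rightarrow> 'p::finite set" and \<kappa> l e t :: real and z :: "real^'p"
    and a v :: "'m \<Rightarrow> real" and S0 S :: "'m set"
  assumes J: "is_group_partition J" and S: "S0 \<subseteq> S"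
    and bound: "\<kappa> * (norm z)\<^sup>2 \<le> (\<Sum>i\<in>S0. (a i + l * v i) * Gmap J z $ i) + (\<Sum>i\<in>S - S0. e * Gmap J z $ i)"
    and t: "t < 1" and l: "0 < l" and v: "\<And>i. v i \<le> 1"
    and e: "0 \<le> e" "(3 - t) * e \<le> l * (1 - t)"
begin

lemma noise_le: "e \<le> l"
proof -
  have "2 * e \<le> (3 - t) * e" "l * (1 - t) \<le> l * (3 - t)" using t e l by (auto intro: mult_right_mono)
  then show ?thesis using e(2) t l
    by (smt (verit) mult.commute mult_le_cancel_left_pos)
qed

text \<open>Cauchy-Schwarz with a constant coefficient on \<open>S\<close>. The bound does not
  involve the previous error and serves to control the number of groups in the next set.\<close>

lemma coarse_error_bound:
  assumes a: "\<And>i. a i \<le> e"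
  shows "\<kappa> * norm z \<le> l * (4 - 2 * t) / (3 - t) * sqrt (card S)"
proof -
  define D where "D = l * (4 - 2 * t) / (3 - t)"
  have D0: "0 \<le> D" using t l by (simp add: D_def)
  have "\<kappa> * (norm z)\<^sup>2 \<le> D * (\<Sum>i\<in>S. Gmap J z $ i)"
    unfolding D_def using S t l a e(2) v
    by (intro order_trans[OF bound] weighted_sum_le) auto
  also have "\<dots> \<le> D * sqrt (card S) * norm z"
    using sum_mult_Gmap_le[OF J, of "\<lambda>i. D" z S] D0 by (simp add: L2_set_constant mult.commute sum_distrib_left)
  finally have "\<kappa> * norm z * norm z \<le> D * sqrt (card S) * norm z"
    by (simp add: power2_eq_square mult_ac)
  then show ?thesis
    using D0 unfolding D_def[symmetric] by (cases "z = 0") auto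
qed

text \<open>Here \<open>y\<close> stands for the previous error. Its groups pay both for the
  remaining penalty on \<open>S0\<close> and for the noise on \<open>S - S0\<close>; the two sums
  merge into one over \<open>S\<close>, and Cauchy-Schwarz gives
  \<open>norm y * norm z\<close>.\<close>

lemma contraction_error_bound:
  assumes on: "\<And>i. i \<in> S0 \<Longrightarrow> v i \<le> \<delta> i + \<tau> * Gmap J y $ i"
    and off: "\<And>i. i \<in> S - S0 \<Longrightarrow> 1 \<le> \<tau> * Gmap J y $ i"
    and \<tau>: "0 \<le> \<tau>"
  shows "\<kappa> * norm z \<le> L2_set a S0 + l * L2_set \<delta> S0 + l * \<tau> * norm y"
proof -
  let ?g = "\<lambda>i. Gmap J z $ i" and ?h = "\<lambda>i. Gmap J y $ i"
  have "(\<Sum>i\<in>S0. (a i + l * v i) * ?g i) \<le> (\<Sum>i\<in>S0. (a i + l * (\<delta> i + \<tau> * ?h i)) * ?g i)"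
    using on l by (intro sum_mono mult_right_mono add_left_mono mult_left_mono) auto
  \<comment> \<open>The noise \<open>e\<close> is at most the full penalty \<open>l\<close>, so a
    group with \<open>\<tau> * ?h i\<close> at least 1 covers it with the same coefficient
    \<open>l * \<tau>\<close> as on \<open>S0\<close>.\<close>
  moreover have "(\<Sum>i\<in>S - S0. e * ?g i) \<le> (\<Sum>i\<in>S - S0. l * \<tau> * ?h i * ?g i)"
  proof (intro sum_mono mult_right_mono)
    fix i assume "i \<in> S - S0"
    then have "l * 1 \<le> l * (\<tau> * ?h i)" using off l by (intro mult_left_mono) auto
    then show "e \<le> l * \<tau> * ?h i" using noise_le by (simp add: mult_ac)
  qed simp
  ultimately have "\<kappa> * (norm z)\<^sup>2 \<le> (\<Sum>i\<in>S0. (a i + l * (\<delta> i + \<tau> * ?h i)) * ?g i)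
      + (\<Sum>i\<in>S - S0. l * \<tau> * ?h i * ?g i)"
    using bound by linarith
  also have "\<dots> = (\<Sum>i\<in>S0. a i * ?g i) + l * (\<Sum>i\<in>S0. \<delta> i * ?g i)
      + l * \<tau> * ((\<Sum>i\<in>S0. ?h i * ?g i) + (\<Sum>i\<in>S - S0. ?h i * ?g i))"
    by (simp add: sum.distrib sum_distrib_left algebra_simps)
  also have "(\<Sum>i\<in>S0. ?h i * ?g i) + (\<Sum>i\<in>S - S0. ?h i * ?g i) = (\<Sum>i\<in>S. ?h i * ?g i)"
    using sum.subset_diff[OF S, of "\<lambda>i. ?h i * ?g i"] by simp
  also have "(\<Sum>i\<in>S0. a i * ?g i) + l * (\<Sum>i\<in>S0. \<delta> i * ?g i) + l * \<tau> * (\<Sum>i\<in>S. ?h i * ?g i)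
      \<le> L2_set a S0 * norm z + l * (L2_set \<delta> S0 * norm z) + l * \<tau> * (norm y * norm z)"
  proof (intro add_mono mult_left_mono sum_mult_Gmap_le[OF J])
    have "(\<Sum>i\<in>S. ?h i * ?g i) \<le> L2_set ?h S * norm z" by (rule sum_mult_Gmap_le[OF J])
    also have "L2_set ?h S \<le> norm y"
      unfolding norm_eq_L2_set_Gmap[OF J] L2_set_def by (intro real_sqrt_le_mono sum_mono2) auto
    finally show "(\<Sum>i\<in>S. ?h i * ?g i) \<le> norm y * norm z" by (simp add: mult_right_mono)
  qed (use l \<tau> in auto)
  finally have "\<kappa> * norm z * norm z
      \<le> (L2_set a S0 + l * L2_set \<delta> S0 + l * \<tau> * norm y) * norm z"
    by (simp add: power2_eq_square algebra_simps)
  moreover have "0 \<le> L2_set a S0 + l * L2_set \<delta> S0 + l * \<tau> * norm y"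
    using l \<tau> by (intro add_nonneg_nonneg mult_nonneg_nonneg) (auto simp: sum_nonneg)
  ultimately show ?thesis by (cases "z = 0") auto
qed

end

text \<open>The fixed point \<open>c / (1 - q)\<close> reproduces itself under the affine map, and
  only the multiple of \<open>d 1\<close> is scaled by \<open>q\<close>; the induction starts at
  index 1.\<close>

lemma affine_recursion_bound:
  fixes d :: "nat \<Rightarrow> real"
  assumes "\<And>k. k \<ge> 1 \<Longrightarrow> d (Suc k) \<le> c + q * d k" and "0 \<le> c" and "0 \<le> q" "q < 1" and "k \<ge> 1"
  shows "d k \<le> c / (1 - q) + q ^ (k - 1) * d 1"
  using \<open>k \<ge> 1\<close>
proof (induction k rule: dec_induct)
  case base
  then show ?case using assms by simp
next
  case (step k)
  have "d (Suc k) \<le> c + q * (c / (1 - q) + q ^ (k - 1) * d 1)"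
    using assms(1)[OF step.hyps(1)] mult_left_mono[OF step.IH assms(3)] by linarith
  also have "\<dots> = c / (1 - q) + q ^ k * d 1"
    using assms(4) step.hyps(1) by (cases k) (auto simp: field_simps)
  finally show ?case by simp
qed

section \<open>From the one-step bounds to all iterates\<close>

theorem theorem4p2:
  fixes A :: "real^'p^'n" and xbar :: "real^'p" and \<epsilon> b :: "real^'n"
    and J :: "'m::finite \<Rightarrow> 'p::finite set"
    and R \<kappa> \<nu> \<rho> :: real and \<phi> :: "real \<Rightarrow> ereal"
    and w :: "nat \<Rightarrow> real^'m" and x :: "nat \<Rightarrow> real^'p"
  defines "Sbar \<equiv> group_supp J xbar"
    and "eps_hat \<equiv> (1 / real CARD('n)) *\<^sub>R (transpose A *v \<epsilon>)"
    and "\<Delta> \<equiv> {i. Gmap J xbar $ i \<le> 2 * left_deriv \<phi> 1 / \<rho>}"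
  assumes "is_group_partition J"
    and "R > 0"
    and "xbar \<in> Omega R"
    and "b = A *v xbar + \<epsilon>"
    and "gep_mscra A b J R \<phi> \<nu> \<rho> w x"
    and "RSC A \<kappa> (cone_C J \<phi> Sbar (1.5 * real (card Sbar)))"
    and "sqrt 3 * (4 - 2 * t_bar \<phi>) * (1 - t_star \<phi>) / ((3 - t_bar \<phi>) * \<kappa>) \<le> \<nu>"
    and "ereal \<nu> \<le> ereal (1 - t_bar \<phi>) / ereal ((3 - t_bar \<phi>) * infnorm (Gmap J eps_hat))"
      (* ereal division: the bound is \<infinity> when the noise term vanishes *)
    and "\<nu> * (3 - t_bar \<phi>) * infnorm (Gmap J eps_hat) / (1 - t_bar \<phi>) \<le> \<rho>"
    and "\<rho> \<le> sqrt ((3 - t_bar \<phi>) * \<kappa> * \<nu> / (sqrt 3 * (4 - 2 * t_bar \<phi>) * (1 - t_star \<phi>)))"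
  shows "\<forall>k\<ge>1. norm (x k - xbar) \<le>
      sqrt 3 * L2_set (($) (Gmap J eps_hat)) Sbar / (\<kappa> * (sqrt 3 - 1))
    + sqrt 3 * \<rho> / (\<kappa> * (sqrt 3 - 1) * \<nu>) * sqrt (\<Sum>i\<in>Sbar. indicator \<Delta> i)
    + (1 / sqrt 3) ^ (k - 1) * norm (x 1 - xbar)"
proof -
  note J = assms(4) and xbar_Omega = assms(6) and b = assms(7) and gep = assms(8) and rsc = assms(9)
    and nu_lower = assms(10) and nu_upper = assms(11) and rho_lower = assms(12) and rho_upper = assms(13)
  define tb where "tb = t_bar \<phi>"
  define ts where "ts = t_star \<phi>"
  define e where "e = infnorm (Gmap J eps_hat)"
  define ld where "ld = left_deriv \<phi> 1"
  define z where "z k = x k - xbar" for k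
  \<comment> \<open>\<open>x (Suc k)\<close> is computed with \<open>l k\<close> and
    \<open>v k\<close>, so penalty and weights run one index behind the error.\<close>
  define l where "l k = lam \<nu> \<rho> k" for k
  define v where "v k i = 1 - w k $ i" for k i
  define S where "S k = Sbar \<union> {i. tb < w k $ i}" for k
  \<comment> \<open>\<open>1 / \<tau>\<close> bounds the error of a misclassified group from below,
    and \<open>\<tau> * l k / \<kappa>\<close> will be the contraction factor.\<close>
  define \<tau> where "\<tau> = \<rho> * (1 - ts)"
  define D where "D = (4 - 2 * tb) / (3 - tb)"
  define r where "r = real (card Sbar)"

  have Phi: "\<phi> \<in> Phi" and nu: "\<nu> > 0" and w0: "\<And>i. 0 \<le> w 0 $ i" "\<And>i. w 0 $ i \<le> tb"
    and rho_bar: "\<rho> > rho_bar A b R \<phi> \<nu>"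
    and x_min: "\<And>k. k \<ge> 1 \<Longrightarrow> is_arg_min (\<lambda>u. ls_loss A b u + l (k - 1) * (\<Sum>i\<in>UNIV. v (k - 1) i * Gmap J u $ i))
        (\<lambda>u. u \<in> Omega R) (x k)"
    and w_min: "\<And>k i. k \<ge> 1 \<Longrightarrow> is_arg_min (\<lambda>t. \<phi> t - ereal (\<rho> * Gmap J (x k) $ i * t)) (\<lambda>t. t \<in> {0..1}) (w k $ i)"
    using gep unfolding gep_mscra_def l_def v_def tb_def by (simp_all add: mult_ac)
  have ts: "0 \<le> ts" "ts \<le> tb" "tb < 1"
    using t_star_facts[OF Phi] t_bar_facts[OF Phi] by (auto simp: ts_def tb_def)
  have ld: "1 / (1 - ts) \<le> ld"
    using left_deriv_ge[OF Phi] by (simp add: ld_def ts_def)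
  have kappa: "\<kappa> > 0" using rsc by (simp add: RSC_def)
  have "0 < 1 / (1 - ts)" using ts by simp
  then have "0 \<le> ld" using ld by linarith
  \<comment> \<open>Positivity of \<open>\<rho>\<close> comes from its lower bound
    \<open>rho_bar\<close>, all of whose factors are nonnegative.\<close>
  then have "0 \<le> rho_bar A b R \<phi> \<nu>"
    unfolding rho_bar_def ts_def[symmetric] ld_def[symmetric] tb_def[symmetric]
    using nu ts lip_const_nonneg[of A b R]
    by (intro mult_nonneg_nonneg divide_nonneg_nonneg) auto
  then have rho: "\<rho> > 0" using rho_bar by linarith
  have tau: "0 \<le> \<tau>" using rho ts by (simp add: \<tau>_def)
  have l_Suc: "l k = \<rho> / \<nu>" if "k \<ge> 1" for k
    using that by (simp add: l_def lam_def)
  have l0: "l 0 = 1 / \<nu>" by (simp add: l_def lam_def)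
  have l: "0 < l k" for k using rho nu by (simp add: l_def lam_def)
  have D: "1 \<le> D" using ts by (simp add: D_def field_simps)

  \<comment> \<open>Consequences of the parameter conditions\<close>
  have e0: "0 \<le> e" by (simp add: e_def infnorm_pos_le)
  have noise: "Gmap J eps_hat $ i \<le> e" for i
    using component_le_infnorm_cart[of "Gmap J eps_hat" i] by (simp add: e_def)
  \<comment> \<open>Round 0 has penalty \<open>1 / \<nu>\<close> and uses the upper bound on
    \<open>\<nu>\<close>; later rounds have \<open>\<rho> / \<nu>\<close> and use the lower bound on
    \<open>\<rho>\<close>. If \<open>e = 0\<close>, the extended-real bound on \<open>\<nu>\<close>
    is infinite, but the claim is then trivial.\<close>
  have e_l: "(3 - tb) * e \<le> l k * (1 - tb)" for k
  proof (cases "k = 0")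
    case True
    show ?thesis
    proof (cases "e = 0")
      case True
      then show ?thesis using l[of k] ts by simp
    next
      case False
      then have "\<nu> \<le> (1 - tb) / ((3 - tb) * e)"
        using nu_upper ts e0 by (simp add: tb_def e_def)
      then show ?thesis using True False e0 nu ts by (simp add: l0 field_simps)
    qed
  next
    case False
    then show ?thesis using rho_lower nu ts by (simp add: l_Suc tb_def[symmetric] e_def[symmetric] field_simps)
  qed

  \<comment> \<open>\<open>q\<close> is the lower bound imposed on \<open>\<nu>\<close>, and the
    upper bound on \<open>\<rho>\<close> is \<open>sqrt (\<nu> / q)\<close>.\<close>
  define q where "q = sqrt 3 * D * (1 - ts) / \<kappa>"
  have q: "0 < q" using D ts kappa by (simp add: q_def)
  have q_nu: "q \<le> \<nu>"
    using nu_lower by (simp add: q_def D_def tb_def ts_def mult_ac)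
  have "\<rho> \<le> sqrt (\<nu> / q)"
    using rho_upper by (simp add: q_def D_def tb_def ts_def mult_ac)
  then have "\<rho>\<^sup>2 \<le> (sqrt (\<nu> / q))\<^sup>2" using rho by (intro power_mono) auto
  then have rho_q: "\<rho>\<^sup>2 * q \<le> \<nu>" using q nu by (simp add: field_simps)
  have rho_l_q: "\<rho> * l k * q \<le> 1" for k
  proof (cases "k = 0")
    case True
    \<comment> \<open>In round 0 both conditions combine: multiplying
      \<open>\<rho>\<^sup>2 * q \<le> \<nu>\<close> by \<open>q \<le> \<nu>\<close> bounds the
      square of \<open>\<rho> * q\<close>.\<close>
    have "(\<rho> * q)\<^sup>2 = (\<rho>\<^sup>2 * q) * q" by (simp add: power2_eq_square)
    also have "\<dots> \<le> \<nu> * \<nu>" using rho_q q_nu q nu by (intro mult_mono) auto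
    finally have "(\<rho> * q)\<^sup>2 \<le> \<nu>\<^sup>2" by (simp add: power2_eq_square)
    then have "\<rho> * q \<le> \<nu>" by (rule power2_le_imp_le) (use nu in simp)
    then show ?thesis using True nu by (simp add: l0)
  next
    case False
    have "\<rho> * \<rho> * q \<le> \<nu>" using rho_q by (simp add: power2_eq_square)
    then show ?thesis using False nu by (simp add: l_Suc)
  qed
  \<comment> \<open>With \<open>D\<close> this estimate serves to count groups; without it, by
    \<open>1 \<le> D\<close>, it bounds the contraction factor.\<close>
  have tau_l_D: "\<tau> * l k * D \<le> \<kappa> / sqrt 3" for k
  proof -
    have "\<rho> * l k * q = \<tau> * l k * D * (sqrt 3 / \<kappa>)" by (simp add: q_def \<tau>_def)
    then show ?thesis using rho_l_q[of k] kappa by (simp add: pos_le_divide_eq)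
  qed
  have "\<tau> * l k \<le> \<tau> * l k * D" for k
    using mult_left_mono[OF D, of "\<tau> * l k"] tau l[of k] by simp
  then have tau_l: "\<tau> * l k \<le> \<kappa> / sqrt 3" for k
    using tau_l_D order_trans by blast

  \<comment> \<open>Weights against errors\<close>
  have w_range: "0 \<le> w k $ i" "w k $ i \<le> 1" for k i
  proof -
    have "0 \<le> w k $ i \<and> w k $ i \<le> 1"
    proof (cases "k = 0")
      case True
      then show ?thesis using w0[of i] ts by auto
    next
      case False
      then show ?thesis using weight_range[OF Phi w_min, of k i] by simp
    qed
    then show "0 \<le> w k $ i" "w k $ i \<le> 1" by auto
  qed
  then have v: "0 \<le> v k i" "v k i \<le> 1" for k i by (auto simp: v_def)
  have off: "1 \<le> \<tau> * Gmap J (z k) $ i" if "k \<ge> 1" "i \<in> S k - Sbar" for k i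
  proof -
    have "1 / (1 - ts) \<le> \<rho> * Gmap J (x k) $ i"
      using weight_gt_t_bar[OF Phi w_min[OF that(1)]] that(2) by (auto simp: S_def tb_def ts_def)
    moreover have "Gmap J (x k) $ i \<le> Gmap J (z k) $ i"
      using Gmap_diff_le[of J "x k" i xbar] Gmap_eq_0[of i J xbar] that(2) by (simp add: z_def Sbar_def)
    ultimately have "1 / (1 - ts) \<le> \<rho> * Gmap J (z k) $ i"
      using rho by (meson mult_left_mono less_imp_le order_trans)
    then show ?thesis using ts by (simp add: \<tau>_def field_simps)
  qed
  have on: "v k i \<le> indicator \<Delta> i + \<tau> * Gmap J (z k) $ i" if "k \<ge> 1" for k i
  proof (cases "i \<in> \<Delta> \<or> w k $ i = 1")
    case True
    then show ?thesis
      using tau v(2)[of k i] by (auto simp: v_def indicator_def add_increasing2)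
  next
    case False
    then have "\<rho> * Gmap J (x k) $ i \<le> ld"
      using weight_less_1[OF Phi w_min[OF that]] w_range(2)[of k i] by (simp add: ld_def)
    \<comment> \<open>The factor 2 in \<open>\<Delta>\<close> leaves a gap: the true group exceeds
      \<open>2 * ld / \<rho>\<close>, that of \<open>x k\<close> is at most
      \<open>ld / \<rho>\<close>, so the error is at least \<open>ld / \<rho>\<close>, where
      \<open>ld\<close> is at least \<open>1 / (1 - ts)\<close>.\<close>
    moreover have "2 * ld < \<rho> * Gmap J xbar $ i"
      using False rho by (simp add: \<Delta>_def ld_def field_simps)
    moreover have "\<rho> * (Gmap J xbar $ i - Gmap J (x k) $ i) \<le> \<rho> * Gmap J (z k) $ i"
      using Gmap_diff_le[of J xbar i "x k"] Gmap_minus_commute[of J xbar "x k" i] rho by (simp add: z_def)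
    ultimately have "1 / (1 - ts) \<le> \<rho> * Gmap J (z k) $ i"
      using ld by (simp add: right_diff_distrib)
    then have "1 \<le> \<tau> * Gmap J (z k) $ i" using ts by (simp add: \<tau>_def field_simps)
    then show ?thesis using v(2)[of k i] by (simp add: add_increasing)
  qed

  have bound: "\<kappa> * (norm (z (Suc k)))\<^sup>2 \<le>
      (\<Sum>i\<in>Sbar. (Gmap J eps_hat $ i + l k * v k i) * Gmap J (z (Suc k)) $ i)
      + (\<Sum>i\<in>S k - Sbar. e * Gmap J (z (Suc k)) $ i)"
    if "real (card (S k)) \<le> 1.5 * r" for k
  proof (rule restricted_basic_bound[OF J rsc])
    have "ls_loss A b (x (Suc k)) + l k * (\<Sum>i\<in>UNIV. v k i * Gmap J (x (Suc k)) $ i)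
      \<le> ls_loss A b xbar + l k * (\<Sum>i\<in>UNIV. v k i * Gmap J xbar $ i)"
      using x_min[of "Suc k"] xbar_Omega unfolding is_arg_min_linorder by simp
    then show "1 / (2 * real CARD('n)) * (norm (A *v z (Suc k)))\<^sup>2 \<le>
      (\<Sum>i\<in>UNIV. Gmap J eps_hat $ i * Gmap J (z (Suc k)) $ i) +
      l k * ((\<Sum>i\<in>Sbar. v k i * Gmap J (z (Suc k)) $ i) - (\<Sum>i\<in>-Sbar. v k i * Gmap J (z (Suc k)) $ i))"
      unfolding z_def Sbar_def eps_hat_def
      using l[of k] v(1) by (intro basic_inequality[OF J b]) auto
    show "real (card (S k)) \<le> 1.5 * real (card Sbar)" using that by (simp add: r_def)
    show "(3 - t_bar \<phi>) * e \<le> l k * (1 - t_bar \<phi>)" using e_l by (simp add: tb_def)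
    show "1 - t_bar \<phi> \<le> v k i" if "i \<notin> S k" for i
      using that by (simp add: S_def v_def tb_def)
  qed (use ts l noise v in \<open>auto simp: S_def tb_def\<close>)
  have SS: "Sbar \<subseteq> S k" for k by (simp add: S_def)

  \<comment> \<open>Initial weights do not exceed \<open>tb\<close>, so the count starts at
    \<open>r\<close>. Afterwards each group outside \<open>Sbar\<close> costs at least 1 in
    \<open>\<tau>\<^sup>2 * h\<^sup>2\<close>, which the coarse bound keeps at or below
    \<open>r / 2\<close>.\<close>
  have card_S: "real (card (S k)) \<le> 1.5 * r" for k
  proof (induction k)
    case 0
    have "S 0 = Sbar" using w0(2) by (auto simp: S_def not_less[symmetric])
    then show ?case by (simp add: r_def)
  next
    case (Suc k)
    define h where "h = norm (z (Suc k))"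
    have "\<kappa> * h \<le> l k * (4 - 2 * tb) / (3 - tb) * sqrt (card (S k))"
      unfolding h_def
      by (rule coarse_error_bound[OF J SS bound[OF Suc.IH] ts(3) l v(2) e0 e_l noise])
    also have "\<dots> = l k * D * sqrt (card (S k))" by (simp add: D_def)
    also have "\<dots> \<le> l k * D * sqrt (1.5 * r)"
      using Suc.IH l[of k] D by (intro mult_left_mono real_sqrt_le_mono mult_nonneg_nonneg) auto
    finally have "\<tau> * (\<kappa> * h) \<le> \<tau> * (l k * D * sqrt (1.5 * r))"
      using tau by (rule mult_left_mono)
    also have "\<dots> = (\<tau> * l k * D) * sqrt (1.5 * r)" by simp
    also have "\<dots> \<le> (\<kappa> / sqrt 3) * sqrt (1.5 * r)"
      using tau_l_D by (intro mult_right_mono) (auto simp: r_def)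
    \<comment> \<open>The constants close the induction: \<open>1.5 * r / 3 = r / 2\<close>, and
      \<open>r / 2\<close> extra groups on top of \<open>r\<close> give \<open>1.5 * r\<close>
      again.\<close>
    also have "sqrt (1.5 * r) = sqrt 3 * sqrt (r / 2)"
      by (simp flip: real_sqrt_mult)
    also have "\<kappa> / sqrt 3 * (sqrt 3 * sqrt (r / 2)) = \<kappa> * sqrt (r / 2)"
      by simp
    finally have "\<tau> * h \<le> sqrt (r / 2)" using kappa by (simp add: mult.left_commute)
    then have "(\<tau> * h)\<^sup>2 \<le> (sqrt (r / 2))\<^sup>2"
      using tau by (intro power_mono) (auto simp: h_def)
    then have th: "\<tau>\<^sup>2 * h\<^sup>2 \<le> r / 2" by (simp add: r_def power_mult_distrib)
    have "real (card (S (Suc k) - Sbar)) = (\<Sum>i\<in>S (Suc k) - Sbar. 1)" by simp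
    also have "\<dots> \<le> (\<Sum>i\<in>S (Suc k) - Sbar. (\<tau> * Gmap J (z (Suc k)) $ i)\<^sup>2)"
      using off[of "Suc k"] by (intro sum_mono) (simp add: one_le_power)
    also have "\<dots> \<le> (\<Sum>i\<in>UNIV. (\<tau> * Gmap J (z (Suc k)) $ i)\<^sup>2)"
      by (intro sum_mono2) auto
    also have "\<dots> = \<tau>\<^sup>2 * h\<^sup>2"
      unfolding h_def norm_eq_L2_set_Gmap[OF J] L2_set_def
      by (simp add: sum_nonneg power_mult_distrib sum_distrib_left)
    finally have "real (card (S (Suc k) - Sbar)) \<le> r / 2" using th by linarith
    moreover have "card (S (Suc k)) = card Sbar + card (S (Suc k) - Sbar)"
      using SS[of "Suc k"] by (simp add: card_Diff_subset card_mono)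
    ultimately show ?case by (simp add: r_def)
  qed

  \<comment> \<open>Contraction of the error\<close>
  define B where "B = L2_set (($) (Gmap J eps_hat)) Sbar + \<rho> / \<nu> * sqrt (\<Sum>i\<in>Sbar. indicator \<Delta> i)"
  have B: "0 \<le> B"
    unfolding B_def using rho nu by (intro add_nonneg_nonneg mult_nonneg_nonneg) (auto simp: sum_nonneg)
  \<comment> \<open>An indicator equals its square.\<close>
  have ind: "L2_set (indicator \<Delta>) Sbar = sqrt (\<Sum>i\<in>Sbar. indicator \<Delta> i)"
    unfolding L2_set_def by (intro arg_cong[where f = sqrt] sum.cong) (auto simp: indicator_def)
  \<comment> \<open>Only from \<open>k = 1\<close> on do the weights come from an iterate, as
    \<open>on\<close> and \<open>off\<close> require.\<close>
  have step: "norm (z (Suc k)) \<le> B / \<kappa> + 1 / sqrt 3 * norm (z k)" if "k \<ge> 1" for k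
  proof -
    have "\<kappa> * norm (z (Suc k)) \<le> L2_set (($) (Gmap J eps_hat)) Sbar
        + l k * L2_set (indicator \<Delta>) Sbar + l k * \<tau> * norm (z k)"
      by (rule contraction_error_bound[OF J SS bound[OF card_S] ts(3) l v(2) e0 e_l on[OF that] off[OF that] tau])
    also have "\<dots> = B + \<tau> * l k * norm (z k)"
      by (simp add: ind B_def l_Suc[OF that])
    also have "\<dots> \<le> B + \<kappa> / sqrt 3 * norm (z k)"
      by (intro add_left_mono mult_right_mono tau_l norm_ge_zero)
    finally show ?thesis using kappa by (simp add: field_simps)
  qed
  have "norm (z k) \<le> B / \<kappa> / (1 - 1 / sqrt 3) + (1 / sqrt 3) ^ (k - 1) * norm (z 1)" if "k \<ge> 1" for k
    by (rule affine_recursion_bound[where d = "\<lambda>k. norm (z k)", OF step _ _ _ that]) (use B kappa in auto)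
  moreover have "B / \<kappa> / (1 - 1 / sqrt 3) = sqrt 3 * B / (\<kappa> * (sqrt 3 - 1))"
    using kappa by (simp add: field_simps)
  moreover have "sqrt 3 * B / (\<kappa> * (sqrt 3 - 1)) =
      sqrt 3 * L2_set (($) (Gmap J eps_hat)) Sbar / (\<kappa> * (sqrt 3 - 1))
    + sqrt 3 * \<rho> / (\<kappa> * (sqrt 3 - 1) * \<nu>) * sqrt (\<Sum>i\<in>Sbar. indicator \<Delta> i)"
    by (simp add: B_def distrib_left add_divide_distrib mult_ac)
  ultimately show ?thesis unfolding z_def by simp
qed

end
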